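(* Let $\mathbb{F}$ be a field of characteristic $0$. If $\big(g(x),F(x)\big)$ is an element of order $k$ in the Riordan group $\mathcal{R}(\mathbb{F})$ with $g_0=1$ (where $g_0$ is the constant term of $g$), then $g(x)$ is of the form $$g(x)=\exp\Big(\varphi\big(x,F(x),\ldots,F^{(k-1)}(x)\big)\Big)$$ for some $k$-cyclic symmetric series $\varphi(x_1,x_2,\ldots,x_k)$.
   Context: $\mathbb{F}_0[[x]]$ is the group, under multiplication, of formal power series over $\mathbb{F}$ with nonzero constant term. $\mathbb{F}_1[[x]]$ is the group, under composition, of formal power series $f_1x+f_2x^2+\cdots$ over $\mathbb{F}$ with $f_1\ne0$. $F^{(m)}$ denotes the $m$-fold composite of $F$ with itself ($F^{(0)}(x)=x$). The Riordan group $\mathcal{R}(\mathbb{F})$ is the set $\mathbb{F}_0[[x]]\times\mathbb{F}_1[[x]]$ with operation $\big(g(x),F(x)\big)\big(h(x),K(x)\big)=\big(g(x)\cdot h(F(x)),\,K(F(x))\big)$ and identity $(1,x)$. The order of a group element is the least positive integer $n$ for which its $n$-th power is the identity. A $k$-cyclic symmetric series is a formal power series $\varphi(x_1,\ldots,x_k)$ over $\mathbb{F}$ in $k$ variables such that $\varphi(x_1,x_2,\ldots,x_k)+\varphi(x_2,x_3,\ldots,x_k,x_1)+\cdots+\varphi(x_k,x_1,\ldots,x_{k-1})=0$. Here $\exp$ is the formal exponential series, applied to a series with zero constant term (a $k$-cyclic symmetric series has zero constant term in characteristic $0$). *)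

theory Defs
  imports
    "HOL-Computational_Algebra.Formal_Power_Series"
    "HOL-Algebra.Multiplicative_Group"
begin

unbundle fps_syntax

definition fps_units :: "'a::field fps set"
  where "fps_units = {g. g $ 0 \<noteq> 0}"

definition fps_comp_units :: "'a::field fps set"
  where "fps_comp_units = {F. F $ 0 = 0 \<and> F $ 1 \<noteq> 0}"

text \<open>The composition \<open>h oo F\<close> of the library is the substitution \<open>h(F(x))\<close>.\<close>

definition riordan_group :: "('a::field fps \<times> 'a fps) monoid"
  where "riordan_group =
    \<lparr>carrier = fps_units \<times> fps_comp_units,
     mult = (\<lambda>(g, F) (h, K). (g * (h oo F), K oo F)),
     one = (1, fps_X)\<rparr>"

lemma fps_compose_nth_1:
  fixes K F :: "'a::field fps"
  assumes "F $ 0 = 0"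
  shows "(K oo F) $ 1 = K $ 1 * F $ 1"
  by (simp add: fps_compose_nth)

lemma fps_inv_in_comp_units:
  assumes "F \<in> fps_comp_units"
  shows "fps_inv F \<in> fps_comp_units"
proof -
  have F: "F $ 0 = 0" "F $ 1 \<noteq> 0"
    using assms by (auto simp: fps_comp_units_def)
  have 0: "fps_inv F $ 0 = 0"
    by (simp add: fps_inv_def)
  have "F $ 1 * fps_inv F $ 1 = 1"
    using fps_compose_nth_1[OF 0, of F] fps_inv_right[OF F] by simp
  with 0 show ?thesis by (auto simp: fps_comp_units_def)
qed

theorem riordan_is_group: "group (riordan_group :: ('a::field fps \<times> 'a fps) monoid)"
proof (rule groupI)
  fix x y z :: "'a fps \<times> 'a fps"
  assume "x \<in> carrier riordan_group" "y \<in> carrier riordan_group"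
  then show "x \<otimes>\<^bsub>riordan_group\<^esub> y \<in> carrier riordan_group"
    by (auto simp: riordan_group_def fps_units_def fps_comp_units_def
        fps_compose_nth_1[simplified] split: prod.splits)
next
  fix x y z :: "'a fps \<times> 'a fps"
  assume "x \<in> carrier riordan_group" "y \<in> carrier riordan_group" "z \<in> carrier riordan_group"
  then show "x \<otimes>\<^bsub>riordan_group\<^esub> y \<otimes>\<^bsub>riordan_group\<^esub> z =
      x \<otimes>\<^bsub>riordan_group\<^esub> (y \<otimes>\<^bsub>riordan_group\<^esub> z)"
    by (auto simp: riordan_group_def fps_units_def fps_comp_units_def
        fps_compose_mult_distrib fps_compose_assoc mult.assoc split: prod.splits)
next
  fix x :: "'a fps \<times> 'a fps"
  assume x: "x \<in> carrier riordan_group"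
  obtain g F where gF: "x = (g, F)" by (cases x)
  have g: "g $ 0 \<noteq> 0" and F: "F \<in> fps_comp_units" "F $ 0 = 0" "F $ 1 \<noteq> 0"
    using x by (auto simp: gF riordan_group_def fps_units_def fps_comp_units_def)
  let ?h = "inverse (g oo fps_inv F)"
  have "(?h, fps_inv F) \<in> carrier riordan_group"
    using g fps_inv_in_comp_units[OF F(1)] by (simp add: riordan_group_def fps_units_def)
  moreover have "?h * (g oo fps_inv F) = 1"
    using g by (intro inverse_mult_eq_1) simp
  then have "(?h, fps_inv F) \<otimes>\<^bsub>riordan_group\<^esub> x = \<one>\<^bsub>riordan_group\<^esub>"
    using fps_inv_right[OF F(2,3)] by (simp add: gF riordan_group_def)
  ultimately show "\<exists>y\<in>carrier riordan_group. y \<otimes>\<^bsub>riordan_group\<^esub> x = \<one>\<^bsub>riordan_group\<^esub>"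
    by blast
qed (auto simp: riordan_group_def fps_units_def fps_comp_units_def)

text \<open>The library's \<^const>\<open>group.ord\<close> is \<open>0\<close> on elements of infinite order; its positive values
  are the least positive exponents annihilating the element.\<close>

lemma (in group) ord_eq_least_iff:
  assumes "x \<in> carrier G" and "0 < k"
  shows "ord x = k \<longleftrightarrow> x [^] k = \<one> \<and> (\<forall>m. 0 < m \<and> m < k \<longrightarrow> x [^] m \<noteq> \<one>)"
proof
  assume "ord x = k"
  then show "x [^] k = \<one> \<and> (\<forall>m. 0 < m \<and> m < k \<longrightarrow> x [^] m \<noteq> \<one>)"
    using assms by (auto simp: pow_eq_id dest: dvd_imp_le)
next
  assume *: "x [^] k = \<one> \<and> (\<forall>m. 0 < m \<and> m < k \<longrightarrow> x [^] m \<noteq> \<one>)"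
  then have dvd: "ord x dvd k" using assms by (simp add: pow_eq_id)
  with assms(2) have "0 < ord x" "ord x \<le> k" by (auto intro: gr0I dest: dvd_imp_le)
  with * show "ord x = k" using pow_ord_eq_1[OF assms(1)] by (metis le_neq_implies_less)
qed

definition fps_iterate :: "'a::field fps \<Rightarrow> nat \<Rightarrow> 'a fps"
  where "fps_iterate F m = ((\<lambda>G. F oo G) ^^ m) fps_X"

text \<open>A formal power series in \<open>k\<close> variables is given by its coefficients; the exponent vector of
  the monomial \<open>x\<^sub>1\<^bsup>\<alpha>\<^sub>1\<^esup> \<cdots> x\<^sub>k\<^bsup>\<alpha>\<^sub>k\<^esup>\<close> is the list \<open>[\<alpha>\<^sub>1, \<dots>, \<alpha>\<^sub>k]\<close>. Requiring the
  coefficients to vanish on lists of other lengths makes this representation unique.\<close>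

type_synonym 'a mfps = "nat list \<Rightarrow> 'a"

definition mfps_carrier :: "nat \<Rightarrow> 'a::zero mfps set"
  where "mfps_carrier k = {\<phi>. \<forall>\<alpha>. length \<alpha> \<noteq> k \<longrightarrow> \<phi> \<alpha> = 0}"

text \<open>\<open>mfps_cycle j \<phi>\<close> is \<open>\<phi>(x\<^bsub>j+1\<^esub>, \<dots>, x\<^sub>k, x\<^sub>1, \<dots>, x\<^sub>j)\<close>: it contains the monomial with exponent
  vector \<open>\<alpha>\<close> with the coefficient of \<open>\<phi>\<close> at \<open>[\<alpha>\<^bsub>j+1\<^esub>, \<dots>, \<alpha>\<^sub>k, \<alpha>\<^sub>1, \<dots>, \<alpha>\<^sub>j]\<close>, since the
  \<open>i\<close>-th argument of \<open>\<phi>\<close> has become \<open>x\<^bsub>i+j\<^esub>\<close>.\<close>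

definition mfps_cycle :: "nat \<Rightarrow> 'a mfps \<Rightarrow> 'a mfps"
  where "mfps_cycle j \<phi> = (\<lambda>\<alpha>. \<phi> (rotate j \<alpha>))"

definition cyclic_symmetric :: "nat \<Rightarrow> 'a::comm_monoid_add mfps \<Rightarrow> bool"
  where "cyclic_symmetric k \<phi> \<longleftrightarrow>
    \<phi> \<in> mfps_carrier k \<and> (\<forall>\<alpha>. (\<Sum>j<k. mfps_cycle j \<phi> \<alpha>) = 0)"

lemma cyclic_symmetric_constant_term:
  fixes \<phi> :: "'a::field_char_0 mfps"
  assumes "cyclic_symmetric k \<phi>" and "0 < k"
  shows "\<phi> (replicate k 0) = 0"
proof -
  have "rotate j (replicate k (0::nat)) = replicate k 0" for j
    by (metis (no_types, lifting) in_set_replicate length_replicate length_rotate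
        replicate_length_same set_rotate)
  then have "of_nat k * \<phi> (replicate k 0) = (\<Sum>j<k. mfps_cycle j \<phi> (replicate k 0))"
    by (simp add: mfps_cycle_def)
  with assms show ?thesis by (simp add: cyclic_symmetric_def)
qed

text \<open>\<open>mfps_subst \<phi> [G\<^sub>1, \<dots>, G\<^sub>k]\<close> is \<open>\<phi>(G\<^sub>1(x), \<dots>, G\<^sub>k(x))\<close>, meant for \<open>G\<^sub>i\<close> with zero constant
  term. Then \<open>G\<^sub>1\<^bsup>\<alpha>\<^sub>1\<^esup> \<cdots> G\<^sub>k\<^bsup>\<alpha>\<^sub>k\<^esup>\<close> contributes to \<open>x\<^sup>n\<close> only if \<open>\<alpha>\<^sub>1 + \<cdots> + \<alpha>\<^sub>k \<le> n\<close>, so the sum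
  below, which is finite, omits only vanishing terms; see the two lemmas that follow.\<close>

definition mfps_monomial :: "'a::comm_semiring_1 fps list \<Rightarrow> nat list \<Rightarrow> 'a fps"
  where "mfps_monomial Gs \<alpha> = (\<Prod>i<length Gs. (Gs ! i) ^ (\<alpha> ! i))"

definition mfps_subst :: "'a::comm_semiring_1 mfps \<Rightarrow> 'a fps list \<Rightarrow> 'a fps"
  where "mfps_subst \<phi> Gs = Abs_fps (\<lambda>n.
    \<Sum>\<alpha> | length \<alpha> = length Gs \<and> sum_list \<alpha> \<le> n. \<phi> \<alpha> * mfps_monomial Gs \<alpha> $ n)"

lemma finite_exponents: "finite {\<alpha>. length \<alpha> = k \<and> sum_list \<alpha> \<le> (n::nat)}"
proof (rule finite_subset)
  show "{\<alpha>. length \<alpha> = k \<and> sum_list \<alpha> \<le> n} \<subseteq> {\<alpha>. set \<alpha> \<subseteq> {..n} \<and> length \<alpha> = k}"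
    using member_le_sum_list order_trans by fastforce
qed (simp add: finite_lists_length_eq)

lemma mfps_monomial_nth_eq_0:
  fixes Gs :: "'a::field fps list"
  assumes "\<And>G. G \<in> set Gs \<Longrightarrow> G $ 0 = 0"
    and "length \<alpha> = length Gs" and "n < sum_list \<alpha>"
  shows "mfps_monomial Gs \<alpha> $ n = 0"
proof -
  have "fps_X dvd Gs ! i" if "i < length Gs" for i
  proof
    show "Gs ! i = fps_X * fps_shift 1 (Gs ! i)"
      using assms(1)[of "Gs ! i"] that by (intro fps_ext) auto
  qed
  then have "(\<Prod>i<length Gs. fps_X ^ (\<alpha> ! i)) dvd mfps_monomial Gs \<alpha>"
    unfolding mfps_monomial_def by (intro prod_dvd_prod dvd_power_same) simp
  moreover have "(\<Prod>i<length Gs. fps_X ^ (\<alpha> ! i)) = (fps_X :: 'a fps) ^ sum_list \<alpha>"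
    using assms(2) by (simp add: power_sum sum_list_sum_nth atLeast0LessThan)
  ultimately obtain c where "mfps_monomial Gs \<alpha> = fps_X ^ sum_list \<alpha> * c"
    by (auto elim: dvdE)
  with assms(3) show ?thesis by (simp add: fps_X_power_mult_nth)
qed

end

theory Submission
  imports Defs
begin

text \<open>
  The series \<open>\<phi>\<close> is built from the logarithm \<open>u\<close> of \<open>g\<close>. The \<open>k\<close>-th power of \<open>(g, F)\<close> has first
  component \<open>\<Prod>j<k. g(F\<^bsup>(j)\<^esup>(x))\<close>, so \<open>(g, F)\<^bsup>k\<^esup> = (1, x)\<close> says, after taking logarithms, that
  \<open>(\<Sum>j<k. u(F\<^bsup>(j)\<^esup>(x))) = 0\<close> (lemmas \<open>riordan_pow\<close> and \<open>sum_eq_0_if_prod_exp_eq_1\<close>). Now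
    \<open>\<phi>(x\<^sub>1, \<dots>, x\<^sub>k) = u(x\<^sub>1) - (u(x\<^sub>1) + \<cdots> + u(x\<^sub>k)) / k\<close>
  is \<open>k\<close>-cyclic symmetric, being the difference of \<open>u(x\<^sub>1)\<close> and its average over all cyclic shifts
  (lemma \<open>cyclic_symmetric_minus_average\<close>). Substituting the iterates of \<open>F\<close> for the variables
  kills this average and leaves \<open>u(x)\<close>.
\<close>

lemma fps_iterate_Suc: "fps_iterate F (Suc m) = F oo fps_iterate F m"
  by (simp add: fps_iterate_def)

lemma fps_iterate_nth_0: "F $ 0 = 0 \<Longrightarrow> fps_iterate F m $ 0 = 0"
  by (induction m) (simp_all add: fps_iterate_def)

lemma riordan_pow:
  "(g, F) [^]\<^bsub>riordan_group\<^esub> n = (\<Prod>j<n. g oo fps_iterate F j, fps_iterate F n)"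
proof (induction n)
  case 0
  show ?case by (simp add: nat_pow_def riordan_group_def fps_iterate_def)
next
  case (Suc n)
  have "(g, F) [^]\<^bsub>riordan_group\<^esub> Suc n =
      (g, F) [^]\<^bsub>riordan_group\<^esub> n \<otimes>\<^bsub>riordan_group\<^esub> (g, F)"
    by (simp add: nat_pow_def)
  then show ?case
    unfolding Suc by (simp add: riordan_group_def fps_iterate_Suc)
qed

lemma fps_exp_ln:
  fixes g :: "'a::field_char_0 fps"
  assumes "g $ 0 = 1"
  shows "fps_exp 1 oo (fps_ln 1 oo (g - 1)) = g"
proof -
  have "(fps_exp 1 - 1) oo fps_ln 1 = (fps_X :: 'a fps)"
    using fps_inv_right[of "fps_exp 1 - 1 :: 'a fps"] fps_ln_fps_exp_inv[of "1::'a"] by simp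
  then have "fps_exp 1 oo fps_ln 1 = (1 + fps_X :: 'a fps)"
    by (simp add: fps_compose_sub_distrib algebra_simps)
  moreover have "fps_exp 1 oo (fps_ln 1 oo (g - 1)) = (fps_exp 1 oo fps_ln 1) oo (g - 1)"
    using assms by (intro fps_compose_assoc) (simp_all add: fps_ln_def)
  ultimately show ?thesis
    using assms by (simp add: fps_compose_add_distrib)
qed

text \<open>The product \<open>P\<close> of the series \<open>exp (u\<^sub>j)\<close> satisfies \<open>P' = (\<Sum>j. u\<^sub>j') P\<close>. So \<open>P = 1\<close> makes
  \<open>\<Sum>j. u\<^sub>j\<close> constant in characteristic \<open>0\<close>.\<close>

lemma sum_eq_0_if_prod_exp_eq_1:
  fixes u :: "'b \<Rightarrow> 'a::field_char_0 fps"
  assumes "finite A" and u0: "\<And>j. j \<in> A \<Longrightarrow> u j $ 0 = 0"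
    and prod: "(\<Prod>j\<in>A. fps_exp 1 oo u j) = 1"
  shows "(\<Sum>j\<in>A. u j) = 0"
proof -
  have "fps_deriv (\<Prod>j\<in>A. fps_exp 1 oo u j) =
      (\<Sum>j\<in>A. fps_deriv (u j)) * (\<Prod>j\<in>A. fps_exp 1 oo u j)"
    using assms(1) u0
    by (induction A) (simp_all add: fps_compose_deriv algebra_simps)
  then have "fps_deriv (\<Sum>j\<in>A. u j) = 0"
    unfolding prod by (simp add: fps_deriv_sum)
  then show ?thesis
    using u0 by (simp add: fps_deriv_eq_0_iff fps_sum_nth)
qed

text \<open>This is \<open>u(x\<^bsub>i+1\<^esub>)\<close> as a series in \<open>x\<^sub>1, \<dots>, x\<^sub>k\<close>; list positions count from \<open>0\<close>.\<close>

definition mfps_of_fps :: "nat \<Rightarrow> nat \<Rightarrow> 'a::zero fps \<Rightarrow> 'a mfps"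
  where "mfps_of_fps k i u =
    (\<lambda>\<alpha>. if length \<alpha> = k \<and> (\<forall>j<k. j \<noteq> i \<longrightarrow> \<alpha> ! j = 0) then u $ (\<alpha> ! i) else 0)"

text \<open>Only the exponent vectors with a single entry \<open>m\<close>, at position \<open>i\<close>, contribute, and their
  monomials are the powers of the \<open>i\<close>-th substituted series. The truncations agree too: both
  substitutions compute the coefficient at \<open>n\<close> from the \<open>m \<le> n\<close> alone.\<close>

lemma mfps_subst_mfps_of_fps:
  fixes u :: "'a::field fps"
  assumes i: "i < length Gs"
  shows "mfps_subst (mfps_of_fps (length Gs) i u) Gs = u oo Gs ! i"
proof (rule fps_ext)
  fix n :: nat
  let ?k = "length Gs"
  let ?e = "\<lambda>m::nat. (replicate ?k 0)[i := m]"
  let ?S = "{\<alpha>. length \<alpha> = ?k \<and> sum_list \<alpha> \<le> n}"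
  have e: "\<alpha> = ?e (\<alpha> ! i)" if "length \<alpha> = ?k" "\<forall>j<?k. j \<noteq> i \<longrightarrow> \<alpha> ! j = 0" for \<alpha>
    using that i by (intro nth_equalityI) (auto simp: nth_list_update)
  have sum_e: "sum_list (?e m) = m" for m
    using i by (simp add: sum_list_update)
  have monomial: "mfps_monomial Gs (?e m) = (Gs ! i) ^ m" for m
  proof -
    have "mfps_monomial Gs (?e m) = (\<Prod>j<?k. if j = i then (Gs ! i) ^ m else 1)"
      unfolding mfps_monomial_def by (intro prod.cong) auto
    then show ?thesis using i by simp
  qed
  have "mfps_subst (mfps_of_fps ?k i u) Gs $ n =
      (\<Sum>\<alpha>\<in>?S. mfps_of_fps ?k i u \<alpha> * mfps_monomial Gs \<alpha> $ n)"
    by (simp add: mfps_subst_def)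
  also have "\<dots> = (\<Sum>\<alpha>\<in>?e ` {0..n}. mfps_of_fps ?k i u \<alpha> * mfps_monomial Gs \<alpha> $ n)"
  proof (rule sum.mono_neutral_right[OF finite_exponents])
    show "?e ` {0..n} \<subseteq> ?S"
      using sum_e by auto
    show "\<forall>\<alpha>\<in>?S - ?e ` {0..n}. mfps_of_fps ?k i u \<alpha> * mfps_monomial Gs \<alpha> $ n = 0"
    proof
      fix \<alpha> assume \<alpha>: "\<alpha> \<in> ?S - ?e ` {0..n}"
      have "\<not> (\<forall>j<?k. j \<noteq> i \<longrightarrow> \<alpha> ! j = 0)"
      proof
        assume "\<forall>j<?k. j \<noteq> i \<longrightarrow> \<alpha> ! j = 0"
        then have "\<alpha> = ?e (\<alpha> ! i)" using \<alpha> e by blast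
        moreover from this have "\<alpha> ! i \<le> n" using \<alpha> sum_e[of "\<alpha> ! i"] by auto
        ultimately show False using \<alpha> by auto
      qed
      then show "mfps_of_fps ?k i u \<alpha> * mfps_monomial Gs \<alpha> $ n = 0"
        by (auto simp: mfps_of_fps_def)
    qed
  qed
  also have "\<dots> = (\<Sum>m=0..n. mfps_of_fps ?k i u (?e m) * mfps_monomial Gs (?e m) $ n)"
    using sum_e by (subst sum.reindex) (auto intro!: inj_onI dest: arg_cong[of _ _ sum_list])
  also have "\<dots> = (\<Sum>m=0..n. u $ m * (Gs ! i) ^ m $ n)"
    unfolding monomial using i by (intro sum.cong) (auto simp: mfps_of_fps_def)
  also have "\<dots> = (u oo Gs ! i) $ n"
    by (simp add: fps_compose_nth)
  finally show "mfps_subst (mfps_of_fps ?k i u) Gs $ n = (u oo Gs ! i) $ n" .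
qed

lemma mfps_cycle_mfps_of_fps:
  assumes "j < k"
  shows "mfps_cycle j (mfps_of_fps k 0 u) = mfps_of_fps k j u"
proof
  fix \<alpha> :: "nat list"
  show "mfps_cycle j (mfps_of_fps k 0 u) \<alpha> = mfps_of_fps k j u \<alpha>"
  proof (cases "length \<alpha> = k")
    case True
    have "(\<forall>l<k. l \<noteq> 0 \<longrightarrow> \<alpha> ! ((j + l) mod k) = 0) \<longleftrightarrow> (\<forall>l<k. l \<noteq> j \<longrightarrow> \<alpha> ! l = 0)"
    proof safe
      fix l assume *: "\<forall>l<k. l \<noteq> 0 \<longrightarrow> \<alpha> ! ((j + l) mod k) = 0" and l: "l < k" "l \<noteq> j"
      \<comment> \<open>the residue of \<open>l - j\<close> modulo \<open>k\<close>, without negative numbers\<close>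
      let ?l = "if j < l then l - j else l + k - j"
      have "?l < k" "?l \<noteq> 0" "(j + ?l) mod k = l"
        using l assms by auto
      then show "\<alpha> ! l = 0" using * by metis
    next
      fix l assume *: "\<forall>l<k. l \<noteq> j \<longrightarrow> \<alpha> ! l = 0" and l: "l < k" "0 < l"
      have "(j + l) mod k \<noteq> j"
        using l assms by (cases "j + l < k") (auto simp: mod_if)
      then show "\<alpha> ! ((j + l) mod k) = 0" using * l by simp
    qed
    then show ?thesis
      using True assms by (auto simp: mfps_cycle_def mfps_of_fps_def nth_rotate)
  qed (simp add: mfps_cycle_def mfps_of_fps_def)
qed

text \<open>A sum over all cyclic shifts is unchanged by a further shift, so summing this average again
  over the \<open>k\<close> shifts returns the sum of the shifts of \<open>\<psi>\<close>, and the difference vanishes.\<close>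

lemma cyclic_symmetric_minus_average:
  fixes \<psi> :: "'a::field_char_0 mfps"
  assumes "0 < k" and "\<psi> \<in> mfps_carrier k"
  shows "cyclic_symmetric k (\<lambda>\<alpha>. \<psi> \<alpha> - (\<Sum>j<k. mfps_cycle j \<psi> \<alpha>) / of_nat k)"
proof -
  define S where "S \<alpha> = (\<Sum>j<k. mfps_cycle j \<psi> \<alpha>)" for \<alpha>
  have S_rotate: "S (rotate m \<alpha>) = S \<alpha>" if "length \<alpha> = k" for \<alpha> m
  proof (induction m)
    case (Suc m)
    let ?\<beta> = "rotate m \<alpha>"
    have "S (rotate1 ?\<beta>) + \<psi> ?\<beta> = (\<Sum>j<Suc k. \<psi> (rotate j ?\<beta>))"
      by (simp add: S_def mfps_cycle_def sum.lessThan_Suc_shift rotate1_rotate_swap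
          del: rotate_rotate sum.lessThan_Suc)
    also have "\<dots> = S ?\<beta> + \<psi> ?\<beta>"
      using that by (simp add: S_def mfps_cycle_def)
    finally show ?case using Suc by simp
  qed simp
  have carrier: "S \<alpha> = 0" "\<psi> \<alpha> = 0" if "length \<alpha> \<noteq> k" for \<alpha>
    using assms(2) that by (simp_all add: S_def mfps_carrier_def mfps_cycle_def)
  have "(\<Sum>j<k. \<psi> (rotate j \<alpha>) - S (rotate j \<alpha>) / of_nat k) = 0" for \<alpha>
  proof (cases "length \<alpha> = k")
    case True
    have "(\<Sum>j<k. \<psi> (rotate j \<alpha>)) = S \<alpha>"
      by (simp add: S_def mfps_cycle_def)
    then show ?thesis
      using assms(1) True by (simp add: sum_subtractf S_rotate)
  qed (simp add: carrier)
  then show ?thesis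
    using carrier unfolding S_def[symmetric]
    by (simp add: cyclic_symmetric_def mfps_carrier_def mfps_cycle_def)
qed

lemma mfps_subst_minus_average:
  fixes \<psi> :: "'a::field mfps"
  shows "mfps_subst (\<lambda>\<alpha>. \<psi> \<alpha> - (\<Sum>j<k. \<chi> j \<alpha>) / c) Gs =
    mfps_subst \<psi> Gs - fps_const (1 / c) * (\<Sum>j<k. mfps_subst (\<chi> j) Gs)"
proof (rule fps_ext)
  fix n :: nat
  let ?S = "{\<alpha>. length \<alpha> = length Gs \<and> sum_list \<alpha> \<le> n}"
  let ?M = "\<lambda>\<alpha>. mfps_monomial Gs \<alpha> $ n"
  have "(\<Sum>\<alpha>\<in>?S. (\<Sum>j<k. \<chi> j \<alpha>) / c * ?M \<alpha>) = (\<Sum>\<alpha>\<in>?S. \<Sum>j<k. 1 / c * (\<chi> j \<alpha> * ?M \<alpha>))"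
    by (simp add: sum_distrib_left sum_distrib_right sum_divide_distrib)
  also have "\<dots> = 1 / c * (\<Sum>j<k. \<Sum>\<alpha>\<in>?S. \<chi> j \<alpha> * ?M \<alpha>)"
    by (subst sum.swap) (simp only: sum_distrib_left)
  finally show "mfps_subst (\<lambda>\<alpha>. \<psi> \<alpha> - (\<Sum>j<k. \<chi> j \<alpha>) / c) Gs $ n =
      (mfps_subst \<psi> Gs - fps_const (1 / c) * (\<Sum>j<k. mfps_subst (\<chi> j) Gs)) $ n"
    by (simp add: mfps_subst_def fps_sum_nth left_diff_distrib sum_subtractf)
qed

theorem mainTheorem4:
  fixes g F :: "'a::field_char_0 fps" and k :: nat
  assumes "(g, F) \<in> carrier riordan_group"
    and "0 < k" and "group.ord riordan_group (g, F) = k"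
    and "g $ 0 = 1"
  shows "\<exists>\<phi>. cyclic_symmetric k \<phi> \<and>
    g = fps_exp 1 oo mfps_subst \<phi> (map (fps_iterate F) [0..<k])"
proof -
  define u where "u = fps_ln 1 oo (g - 1)"
  have u0: "u $ 0 = 0" and exp_u: "fps_exp 1 oo u = g"
    using assms(4) by (simp_all add: u_def fps_exp_ln)
  have F0: "fps_iterate F j $ 0 = 0" for j
    using assms(1) by (intro fps_iterate_nth_0) (simp add: riordan_group_def fps_comp_units_def)
  have "(g, F) [^]\<^bsub>riordan_group\<^esub> k = \<one>\<^bsub>riordan_group\<^esub>"
    using group.pow_ord_eq_1[OF riordan_is_group assms(1)] assms(3) by simp
  then have "(\<Prod>j<k. g oo fps_iterate F j) = 1"
    unfolding riordan_pow by (simp add: riordan_group_def)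
  moreover have "g oo fps_iterate F j = fps_exp 1 oo (u oo fps_iterate F j)" for j
    using F0 u0 by (simp add: fps_compose_assoc exp_u)
  ultimately have sum_0: "(\<Sum>j<k. u oo fps_iterate F j) = 0"
    using u0 by (intro sum_eq_0_if_prod_exp_eq_1) simp_all

  define \<psi> where "\<psi> = mfps_of_fps k 0 u"
  define \<phi> where "\<phi> = (\<lambda>\<alpha>. \<psi> \<alpha> - (\<Sum>j<k. mfps_cycle j \<psi> \<alpha>) / of_nat k)"
  let ?Gs = "map (fps_iterate F) [0..<k]"
  have "\<psi> \<in> mfps_carrier k"
    by (simp add: \<psi>_def mfps_of_fps_def mfps_carrier_def)
  then have cyclic: "cyclic_symmetric k \<phi>"
    unfolding \<phi>_def using assms(2) by (rule cyclic_symmetric_minus_average[rotated])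
  have subst: "mfps_subst (mfps_of_fps k j u) ?Gs = u oo fps_iterate F j" if "j < k" for j
    using mfps_subst_mfps_of_fps[of j ?Gs u] that by simp
  have "mfps_subst \<phi> ?Gs =
      (u oo fps_iterate F 0) - fps_const (1 / of_nat k) * (\<Sum>j<k. u oo fps_iterate F j)"
    unfolding \<phi>_def mfps_subst_minus_average \<psi>_def
    using assms(2) by (simp add: subst mfps_cycle_mfps_of_fps)
  then have "mfps_subst \<phi> ?Gs = u"
    unfolding sum_0 by (simp add: fps_iterate_def)
  with cyclic exp_u show ?thesis by auto
qed

end
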